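(* Let $\mu>0$, let $N\ge 2$ be an integer such that $N\mu\in\mathbb{N}$, and let $(\mathbf{X}(t))_{t\in\mathbb{N}}$, $\mathbf{X}(t)=(X_1(t),\ldots,X_N(t))$, be the discrete time binomial reshuffling model with $N$ agents, with values in $\mathcal{A}_{N,\mu}$ and with an arbitrary initial configuration in $\mathcal{A}_{N,\mu}$. Then for each fixed $n\in\mathbb{N}$, $$\lim_{t\to\infty}\mathbb{P}\left(X_1(t)=n\right)=\binom{N\mu}{n}\left(\frac1N\right)^n\left(1-\frac1N\right)^{N\mu-n}.$$ Consequently, $$\lim_{N\to\infty}\lim_{t\to\infty}\mathbb{P}\left(X_1(t)=n\right)=\frac{\mu^n e^{-\mu}}{n!},$$ where $\mu$ and $n$ are fixed and the limit in $N$ is taken over integers $N$ with $N\mu\in\mathbb{N}$ (when such $N$ exist).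
   Context: $\mathbb{N}=\{0,1,2,\ldots\}$, and $\binom{m}{n}=0$ if $n>m$. The configuration space is $$\mathcal{A}_{N,\mu}=\left\{\mathbf{X}=(X_1,\ldots,X_N)\in\mathbb{N}^N:\ \sum_{i=1}^N X_i=N\mu\right\}.$$ The discrete time binomial reshuffling model is the Markov chain on $\mathcal{A}_{N,\mu}$ evolving as follows. At each time step an unordered pair of distinct agents $\{i,j\}\subset\{1,\ldots,N\}$ is chosen uniformly at random (each pair with probability $\frac{2}{N(N-1)}$), and their wealth is updated by $$(X_i,X_j)\mapsto\left(B\circ(X_i+X_j),\ X_i+X_j-B\circ(X_i+X_j)\right),$$ while all other coordinates are unchanged. Here, conditionally on the current configuration and the chosen pair, $B\circ(X_i+X_j)$ is a binomial random variable with parameters $X_i+X_j$ and $1/2$. Choices at different time steps use independent randomness. *)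

theory Defs
  imports "HOL-Probability.Probability"
begin

definition configurations :: "nat \<Rightarrow> real \<Rightarrow> (nat \<Rightarrow> nat) set" where
  "configurations N \<mu> =
     {x \<in> {1..N} \<rightarrow>\<^sub>E UNIV. real (\<Sum>i=1..N. x i) = real N * \<mu>}"

(* An unordered pair {i, j} of distinct agents is represented by (i, j) with i < j. The
   orientation is immaterial: if B is binomial with parameters s and 1/2, so is s - B. *)
definition agent_pairs :: "nat \<Rightarrow> (nat \<times> nat) set" where
  "agent_pairs N = {(i, j). 1 \<le> i \<and> i < j \<and> j \<le> N}"

(* Meaningful for 2 \<le> N only, since pmf_of_set needs a nonempty set. *)
definition reshuffle_step :: "nat \<Rightarrow> (nat \<Rightarrow> nat) \<Rightarrow> (nat \<Rightarrow> nat) pmf" where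
  "reshuffle_step N x =
     bind_pmf (pmf_of_set (agent_pairs N)) (\<lambda>(i, j).
       map_pmf (\<lambda>b. x(i := b, j := x i + x j - b)) (binomial_pmf (x i + x j) (1/2)))"

(* The Markov property is with respect to the whole past, and the law of the initial
   configuration X 0 is unconstrained (deterministic or random). *)
definition binomial_reshuffling ::
    "'a measure \<Rightarrow> nat \<Rightarrow> real \<Rightarrow> (nat \<Rightarrow> 'a \<Rightarrow> nat \<Rightarrow> nat) \<Rightarrow> bool" where
  "binomial_reshuffling M N \<mu> X \<longleftrightarrow>
     prob_space M \<and>
     (\<forall>t. X t \<in> measurable M (count_space (configurations N \<mu>))) \<and>
     (\<forall>t x y. \<P>(\<omega> in M. \<forall>s\<le>t. X s \<omega> = x s) > 0 \<longrightarrow>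
        \<P>(\<omega> in M. X (Suc t) \<omega> = y \<bar> \<forall>s\<le>t. X s \<omega> = x s) = pmf (reshuffle_step N (x t)) y)"

end

theory Submission
  imports Defs "HOL-Real_Asymp.Real_Asymp"
begin

text \<open>
  The proof rests on a duality between the reshuffling of wealth and the averaging of weights.
  Give agent \<open>k\<close> a weight \<open>u k\<close> and consider the monomial \<open>\<Prod>k. u k ^ x k\<close> of a configuration
  \<open>x\<close>. Reshuffling the pair \<open>{i, j}\<close> sends each dollar of the pair to \<open>i\<close> or to \<open>j\<close> by an
  independent fair coin, so by the binomial theorem the expected monomial after the reshuffling
  is the old monomial with both \<open>u i\<close> and \<open>u j\<close> replaced by their mean
  (\<open>expectation_monomial_step\<close>). Hence the expected monomial at time \<open>t\<close> is obtained by averaging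
  \<open>t\<close> random pairs of weights and evaluating at the initial configuration.

  Averaging random pairs preserves the mean of the weights and contracts the total distance
  between them by a factor below \<open>1\<close> on average (\<open>spread_average_contracts\<close>). So the weights
  become equal in the limit, and the expected monomial tends to \<open>c ^ m\<close>, where \<open>c\<close> is the mean
  weight and \<open>m\<close> the total wealth, whatever the initial configuration
  (\<open>expectation_monomial_bound\<close>).

  For the weights \<open>(s, 1, \<dots>, 1)\<close> the monomial is \<open>s ^ x 1\<close>: the generating function of
  \<open>X\<^sub>1(t)\<close> converges at every \<open>s \<in> [0, 1]\<close> to \<open>(s / N + 1 - 1 / N) ^ m\<close>, the generating function
  of the binomial distribution. Both are polynomials of degree at most \<open>m\<close>, so their coefficients
  converge too (\<open>coeff_tendsto_0\<close>), which is the first claim. The second one is the classical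
  Poisson limit of binomial probabilities (\<open>binomial_tendsto_poisson\<close>).
\<close>

section \<open>Monomials and averaging\<close>

definition monomial :: "nat \<Rightarrow> (nat \<Rightarrow> real) \<Rightarrow> (nat \<Rightarrow> nat) \<Rightarrow> real" where
  "monomial N u x = (\<Prod>k=1..N. u k ^ x k)"

definition average_at :: "nat \<Rightarrow> nat \<Rightarrow> (nat \<Rightarrow> real) \<Rightarrow> nat \<Rightarrow> real" where
  "average_at i j u = u(i := (u i + u j) / 2, j := (u i + u j) / 2)"

definition spread :: "nat \<Rightarrow> (nat \<Rightarrow> real) \<Rightarrow> real" where
  "spread N u = (\<Sum>k=1..N. \<Sum>l=1..N. \<bar>u k - u l\<bar>)"

lemma finite_agent_pairs: "finite (agent_pairs N)"
  by (rule finite_subset[of _ "{1..N} \<times> {1..N}"]) (auto simp: agent_pairs_def)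

lemma agent_pairs_nonempty: "2 \<le> N \<Longrightarrow> agent_pairs N \<noteq> {}"
proof -
  assume "2 \<le> N"
  then have "(1, 2) \<in> agent_pairs N" by (simp add: agent_pairs_def)
  then show ?thesis by blast
qed

lemma agents_split:
  assumes "(i, j) \<in> agent_pairs N"
  shows "{1..N} = insert i (insert j ({1..N} - {i, j}))" "i \<noteq> j"
  using assms by (auto simp: agent_pairs_def)

lemma sum_agents_split:
  fixes g :: "nat \<Rightarrow> 'b::comm_monoid_add"
  assumes "(i, j) \<in> agent_pairs N"
  shows "(\<Sum>k=1..N. g k) = g i + (g j + (\<Sum>k\<in>{1..N} - {i, j}. g k))"
  by (subst agents_split(1)[OF assms]) (use agents_split(2)[OF assms] in simp)

lemma prod_agents_split:
  fixes g :: "nat \<Rightarrow> 'b::comm_monoid_mult"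
  assumes "(i, j) \<in> agent_pairs N"
  shows "(\<Prod>k=1..N. g k) = g i * (g j * (\<Prod>k\<in>{1..N} - {i, j}. g k))"
  by (subst agents_split(1)[OF assms]) (use agents_split(2)[OF assms] in simp)

lemma sum_average_at:
  assumes "(i, j) \<in> agent_pairs N"
  shows "(\<Sum>k=1..N. average_at i j u k) = (\<Sum>k=1..N. u k)"
proof -
  have "(\<Sum>k\<in>{1..N} - {i, j}. average_at i j u k) = (\<Sum>k\<in>{1..N} - {i, j}. u k)"
    by (intro sum.cong) (auto simp: average_at_def)
  then show ?thesis
    using agents_split(2)[OF assms]
    by (simp add: sum_agents_split[OF assms] average_at_def del: One_nat_def)
qed

text \<open>
  Averaging \<open>u i\<close> and \<open>u j\<close> removes the distance between them, which the spread counts in both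
  orders. The distances to a third weight \<open>u k\<close> do not grow in total: by convexity, twice the
  distance from \<open>u k\<close> to the mean is at most the sum of its distances to \<open>u i\<close> and \<open>u j\<close>.
\<close>

lemma spread_average_at:
  assumes ij: "(i, j) \<in> agent_pairs N"
  shows "spread N (average_at i j u) \<le> spread N u - 2 * \<bar>u i - u j\<bar>"
proof -
  define R where "R = {1..N} - {i, j}"
  have expand: "spread N v =
      2 * \<bar>v i - v j\<bar> + 2 * (\<Sum>k\<in>R. \<bar>v k - v i\<bar> + \<bar>v k - v j\<bar>)
        + (\<Sum>k\<in>R. \<Sum>l\<in>R. \<bar>v k - v l\<bar>)" for v
    unfolding spread_def R_def
    by (simp add: sum_agents_split[OF ij] sum.distrib abs_minus_commute del: One_nat_def)
  let ?v = "average_at i j u"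
  have eq: "?v i = (u i + u j) / 2" "?v j = (u i + u j) / 2" "\<And>k. k \<in> R \<Longrightarrow> ?v k = u k"
    using agents_split(2)[OF ij] by (auto simp: average_at_def R_def)
  have "(\<Sum>k\<in>R. \<bar>?v k - ?v i\<bar> + \<bar>?v k - ?v j\<bar>) \<le> (\<Sum>k\<in>R. \<bar>u k - u i\<bar> + \<bar>u k - u j\<bar>)"
    by (intro sum_mono) (auto simp: eq abs_if field_simps)
  moreover have "(\<Sum>k\<in>R. \<Sum>l\<in>R. \<bar>?v k - ?v l\<bar>) = (\<Sum>k\<in>R. \<Sum>l\<in>R. \<bar>u k - u l\<bar>)"
    by (simp add: eq)
  ultimately show ?thesis
    by (simp add: expand eq)
qed

lemma spread_eq_sum_agent_pairs:
  "spread N u = (\<Sum>(i, j)\<in>agent_pairs N. 2 * \<bar>u i - u j\<bar>)"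
proof -
  let ?d = "\<lambda>(k, l). \<bar>u k - u l\<bar>"
  let ?A = "agent_pairs N" and ?D = "(\<lambda>k. (k, k)) ` {1..N}"
  have split: "{1..N} \<times> {1..N} = ?A \<union> prod.swap ` ?A \<union> ?D"
  proof (intro subset_antisym subsetI)
    fix p assume "p \<in> {1..N} \<times> {1..N}"
    then obtain k l where p: "p = (k, l)" "1 \<le> k" "k \<le> N" "1 \<le> l" "l \<le> N" by auto
    consider "k < l" | "l < k" | "k = l" by linarith
    then show "p \<in> ?A \<union> prod.swap ` ?A \<union> ?D"
    proof cases
      case 2
      then have "(l, k) \<in> ?A" using p by (auto simp: agent_pairs_def)
      then have "prod.swap (l, k) \<in> prod.swap ` ?A" by (rule imageI)
      then show ?thesis using p by simp
    qed (use p in \<open>auto simp: agent_pairs_def\<close>)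
  qed (auto simp: agent_pairs_def)
  have "spread N u = sum ?d ({1..N} \<times> {1..N})"
    by (simp add: spread_def sum.cartesian_product)
  also have "\<dots> = sum ?d (?A \<union> prod.swap ` ?A) + sum ?d ?D"
    unfolding split using finite_agent_pairs[of N]
    by (intro sum.union_disjoint) (auto simp: agent_pairs_def)
  also have "sum ?d (?A \<union> prod.swap ` ?A) = sum ?d ?A + sum ?d (prod.swap ` ?A)"
    using finite_agent_pairs[of N] by (intro sum.union_disjoint) (auto simp: agent_pairs_def)
  also have "sum ?d (prod.swap ` ?A) = sum ?d ?A"
    by (subst sum.reindex) (auto simp: case_prod_beta abs_minus_commute intro!: sum.cong)
  also have "sum ?d ?D = 0"
    by (intro sum.neutral) auto
  finally show ?thesis
    by (simp add: case_prod_beta sum_distrib_left[symmetric])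
qed

definition contraction_rate :: "nat \<Rightarrow> real" where
  "contraction_rate N = 1 - 1 / card (agent_pairs N)"

lemma contraction_rate_bounds:
  assumes "2 \<le> N"
  shows "0 \<le> contraction_rate N" "contraction_rate N < 1"
proof -
  have "card (agent_pairs N) \<ge> 1"
    using agent_pairs_nonempty[OF assms] finite_agent_pairs[of N]
    by (simp add: Suc_leI card_gt_0_iff)
  then show "0 \<le> contraction_rate N" "contraction_rate N < 1"
    by (simp_all add: contraction_rate_def field_simps)
qed

text \<open>
  Summed over all pairs, the distances removed in \<open>spread_average_at\<close> amount to exactly one full
  spread.
\<close>

lemma spread_average_contracts:
  assumes "2 \<le> N"
  shows "(\<Sum>(i, j)\<in>agent_pairs N. spread N (average_at i j u)) / card (agent_pairs N)
           \<le> contraction_rate N * spread N u"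
proof -
  let ?c = "real (card (agent_pairs N))"
  have c: "?c > 0"
    using agent_pairs_nonempty[OF assms] finite_agent_pairs[of N] by (simp add: card_gt_0_iff)
  have "(\<Sum>(i, j)\<in>agent_pairs N. spread N (average_at i j u))
          \<le> (\<Sum>(i, j)\<in>agent_pairs N. spread N u - 2 * \<bar>u i - u j\<bar>)"
    by (intro sum_mono) (auto intro: spread_average_at)
  also have "\<dots> = ?c * spread N u - spread N u"
    by (subst (3) spread_eq_sum_agent_pairs) (simp add: case_prod_beta sum_subtractf)
  finally show ?thesis
    using c by (simp add: contraction_rate_def field_simps)
qed

text \<open>
  For constant weights \<open>c\<close> the monomial is \<open>c ^ m\<close>, and on \<open>[0, 1]\<close> a product of \<open>m\<close> factors is
  \<open>1\<close>-Lipschitz in each factor; every weight is within one spread of the mean.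
\<close>

lemma monomial_diff_le_spread:
  assumes "1 \<le> N" and u: "\<And>k. 0 \<le> u k" "\<And>k. u k \<le> 1" and m: "(\<Sum>k=1..N. x k) = m"
  shows "\<bar>monomial N u x - ((\<Sum>k=1..N. u k) / N) ^ m\<bar> \<le> m * spread N u"
proof -
  define c where "c = (\<Sum>k=1..N. u k) / N"
  have "(\<Sum>k=1..N. u k) \<le> (\<Sum>k=1..N. 1)" using u by (intro sum_mono) auto
  then have c: "0 \<le> c" "c \<le> 1"
    using assms by (auto simp: c_def field_simps intro!: sum_nonneg)
  have dev: "\<bar>u k - c\<bar> \<le> spread N u" if "k \<in> {1..N}" for k
  proof -
    have "u k - c = (\<Sum>l=1..N. u k - u l) / N"
      using \<open>1 \<le> N\<close> by (simp add: c_def sum_subtractf field_simps)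
    then have "\<bar>u k - c\<bar> \<le> (\<Sum>l=1..N. \<bar>u k - u l\<bar>) / N"
      by (simp add: divide_right_mono)
    also have "\<dots> \<le> (\<Sum>l=1..N. \<bar>u k - u l\<bar>)"
      using \<open>1 \<le> N\<close> divide_left_mono[of 1 "real N" "\<Sum>l=1..N. \<bar>u k - u l\<bar>"]
      by (simp add: sum_nonneg)
    also have "\<dots> \<le> spread N u"
      unfolding spread_def using that
      by (intro member_le_sum[where f = "\<lambda>k. \<Sum>l=1..N. \<bar>u k - u l\<bar>"] sum_nonneg) auto
    finally show ?thesis .
  qed
  have "c ^ m = (\<Prod>k=1..N. c ^ x k)"
    unfolding m[symmetric] by (rule power_sum)
  then have "\<bar>monomial N u x - c ^ m\<bar> \<le> (\<Sum>k=1..N. \<bar>u k ^ x k - c ^ x k\<bar>)"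
    using norm_prod_diff[of "{1..N}" "\<lambda>k. u k ^ x k" "\<lambda>k. c ^ x k"] u c
    by (simp add: monomial_def power_le_one)
  also have "\<dots> \<le> (\<Sum>k=1..N. x k * spread N u)"
  proof (rule sum_mono)
    fix k assume k: "k \<in> {1..N}"
    have "\<bar>u k ^ x k - c ^ x k\<bar> \<le> x k * \<bar>u k - c\<bar>"
      using norm_power_diff[of "u k" c "x k"] u c by simp
    also have "\<dots> \<le> x k * spread N u"
      using dev[OF k] by (intro mult_left_mono) auto
    finally show "\<bar>u k ^ x k - c ^ x k\<bar> \<le> x k * spread N u" .
  qed
  also have "\<dots> = m * spread N u"
    by (simp add: m[symmetric] sum_distrib_right)
  finally show ?thesis unfolding c_def .
qed

section \<open>One step of the chain\<close>

lemma finite_configurations: "finite (configurations N \<mu>)"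
proof (rule finite_subset)
  show "configurations N \<mu> \<subseteq> {1..N} \<rightarrow>\<^sub>E {..nat \<lfloor>real N * \<mu>\<rfloor>}"
  proof
    fix x assume x: "x \<in> configurations N \<mu>"
    then have s: "real (\<Sum>i=1..N. x i) = real N * \<mu>" and E: "x \<in> {1..N} \<rightarrow>\<^sub>E UNIV"
      unfolding configurations_def by auto
    have "x i \<le> nat \<lfloor>real N * \<mu>\<rfloor>" if "i \<in> {1..N}" for i
      using that member_le_sum[of i "{1..N}" x]
      unfolding s[symmetric] by (simp del: of_nat_sum)
    then show "x \<in> {1..N} \<rightarrow>\<^sub>E {..nat \<lfloor>real N * \<mu>\<rfloor>}" using E by (auto simp: PiE_iff)
  qed
qed (auto intro: finite_PiE)

lemma set_pmf_reshuffle_step: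
  assumes "2 \<le> N"
  shows "set_pmf (reshuffle_step N x) =
    (\<Union>(i, j)\<in>agent_pairs N. (\<lambda>b. x(i := b, j := x i + x j - b)) ` {..x i + x j})"
  using agent_pairs_nonempty[OF assms] finite_agent_pairs[of N]
  by (auto simp: reshuffle_step_def set_bind_pmf)

lemma reshuffle_step_configurations:
  assumes "2 \<le> N" "x \<in> configurations N \<mu>" "y \<in> set_pmf (reshuffle_step N x)"
  shows "y \<in> configurations N \<mu>"
proof -
  obtain i j b where ij: "(i, j) \<in> agent_pairs N" and b: "b \<le> x i + x j"
    and y: "y = x(i := b, j := x i + x j - b)"
    using assms(3) by (auto simp: set_pmf_reshuffle_step[OF assms(1)])
  have "(\<Sum>k\<in>{1..N} - {i, j}. y k) = (\<Sum>k\<in>{1..N} - {i, j}. x k)"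
    by (intro sum.cong) (auto simp: y)
  then have "(\<Sum>k=1..N. y k) = (\<Sum>k=1..N. x k)"
    using agents_split(2)[OF ij] b by (simp add: sum_agents_split[OF ij] y del: One_nat_def)
  moreover have "y \<in> {1..N} \<rightarrow>\<^sub>E UNIV"
    using assms(2) ij by (auto simp: configurations_def y agent_pairs_def PiE_iff extensional_def)
  ultimately show ?thesis
    using assms(2) by (simp add: configurations_def del: of_nat_sum)
qed

text \<open>
  The duality. Given the pair \<open>(i, j)\<close>, the expectation over the binomial variable is the binomial
  expansion of \<open>((u i + u j) / 2) ^ (x i + x j)\<close>, that is, of the two factors of the monomial that
  have averaged weights.
\<close>

lemma expectation_monomial_step:
  assumes "2 \<le> N"
  shows "measure_pmf.expectation (reshuffle_step N x) (monomial N u) =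
    (\<Sum>(i, j)\<in>agent_pairs N. monomial N (average_at i j u) x) / card (agent_pairs N)"
proof -
  let ?K = "\<lambda>(i, j). map_pmf (\<lambda>b. x(i := b, j := x i + x j - b)) (binomial_pmf (x i + x j) (1/2))"
  have pair: "measure_pmf.expectation (?K (i, j)) (monomial N u) = monomial N (average_at i j u) x"
    if ij: "(i, j) \<in> agent_pairs N" for i j
  proof -
    define r where "r = (\<Prod>k\<in>{1..N} - {i, j}. u k ^ x k)"
    let ?n = "x i + x j"
    have r: "monomial N u (x(i := b, j := ?n - b)) = u i ^ b * (u j ^ (?n - b) * r)" for b
    proof -
      have "(\<Prod>k\<in>{1..N} - {i, j}. u k ^ (x(i := b, j := ?n - b)) k) = r"
        unfolding r_def by (intro prod.cong) auto
      then show ?thesis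
        using agents_split(2)[OF ij] by (simp add: monomial_def prod_agents_split[OF ij] del: One_nat_def)
    qed
    have "measure_pmf.expectation (?K (i, j)) (monomial N u) =
      (\<Sum>b\<le>?n. real (?n choose b) * (1/2) ^ b * (1/2) ^ (?n - b) * (u i ^ b * (u j ^ (?n - b) * r)))"
      by (simp add: expectation_binomial_pmf' r del: fun_upd_apply)
    also have "\<dots> = (\<Sum>b\<le>?n. real (?n choose b) * (u i / 2) ^ b * (u j / 2) ^ (?n - b)) * r"
      unfolding sum_distrib_right by (intro sum.cong) (simp_all add: power_divide)
    also have "\<dots> = (u i / 2 + u j / 2) ^ ?n * r"
      by (simp add: binomial_ring)
    also have "\<dots> = monomial N (average_at i j u) x"
    proof -
      have "(\<Prod>k\<in>{1..N} - {i, j}. average_at i j u k ^ x k) = r"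
        unfolding r_def by (intro prod.cong) (auto simp: average_at_def)
      then show ?thesis
        using agents_split(2)[OF ij]
        by (simp add: monomial_def prod_agents_split[OF ij] average_at_def power_add
                      add_divide_distrib del: One_nat_def)
    qed
    finally show ?thesis .
  qed
  have "measure_pmf.expectation (reshuffle_step N x) (monomial N u) =
    (\<Sum>p\<in>agent_pairs N. measure_pmf.expectation (?K p) (monomial N u) /\<^sub>R card (agent_pairs N))"
    unfolding reshuffle_step_def
    using agent_pairs_nonempty[OF assms] finite_agent_pairs[of N]
    by (intro pmf_expectation_bind_pmf_of_set) auto
  also have "\<dots> = (\<Sum>(i, j)\<in>agent_pairs N. monomial N (average_at i j u) x / card (agent_pairs N))"
    by (intro sum.cong refl) (use pair in \<open>auto simp: field_simps\<close>)
  finally show ?thesis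
    by (simp add: sum_divide_distrib case_prod_beta)
qed

section \<open>The law of the chain\<close>

lemma (in prob_space) expectation_finite_range:
  fixes g :: "'b \<Rightarrow> real"
  assumes Z: "Z \<in> measurable M (count_space T)" and T: "finite T"
  shows "expectation (\<lambda>\<omega>. g (Z \<omega>)) = (\<Sum>z\<in>T. g z * \<P>(\<omega> in M. Z \<omega> = z))"
proof -
  have ev: "{\<omega>\<in>space M. Z \<omega> = z} \<in> events" if "z \<in> T" for z
    using measurable_sets[OF Z, of "{z}"] that by (simp add: vimage_def Int_def conj_commute)
  have "expectation (\<lambda>\<omega>. g (Z \<omega>)) =
    expectation (\<lambda>\<omega>. \<Sum>z\<in>T. g z * indicator {\<omega>\<in>space M. Z \<omega> = z} \<omega>)"
  proof (rule Bochner_Integration.integral_cong[OF refl])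
    fix \<omega> assume \<omega>: "\<omega> \<in> space M"
    then have "Z \<omega> \<in> T" using measurable_space[OF Z] by simp
    then show "g (Z \<omega>) = (\<Sum>z\<in>T. g z * indicator {\<omega>\<in>space M. Z \<omega> = z} \<omega>)"
      using \<omega> T by (simp add: indicator_def of_bool_def if_distrib cong: if_cong)
  qed
  also have "\<dots> = (\<Sum>z\<in>T. g z * \<P>(\<omega> in M. Z \<omega> = z))"
    using ev by (subst Bochner_Integration.integral_sum)
      (auto simp: emeasure_eq_measure intro!: integrable_real_mult_indicator sum.cong)
  finally show ?thesis .
qed

locale reshuffling_chain = prob_space M
  for M :: "'a measure" +
  fixes N m :: nat and \<mu> :: real and X :: "nat \<Rightarrow> 'a \<Rightarrow> nat \<Rightarrow> nat"
  assumes two_agents: "2 \<le> N"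
    and total: "real N * \<mu> = real m"
    and chain: "binomial_reshuffling M N \<mu> X"
begin

lemma measurable_X: "X t \<in> measurable M (count_space (configurations N \<mu>))"
  using chain by (simp add: binomial_reshuffling_def)

lemma X_in_configurations: "\<omega> \<in> space M \<Longrightarrow> X t \<omega> \<in> configurations N \<mu>"
  using measurable_space[OF measurable_X] by simp

lemma sum_configuration: "x \<in> configurations N \<mu> \<Longrightarrow> (\<Sum>k=1..N. x k) = m"
  unfolding configurations_def total by (simp only: mem_Collect_eq of_nat_eq_iff)

lemma event_X: "{\<omega>\<in>space M. P (X t \<omega>)} \<in> events"
proof -
  have "{\<omega>\<in>space M. P (X t \<omega>)} = X t -` {x \<in> configurations N \<mu>. P x} \<inter> space M"
    using X_in_configurations by auto
  then show ?thesis
    using measurable_sets[OF measurable_X, of "{x \<in> configurations N \<mu>. P x}" t] by simp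
qed

text \<open>
  The Markov property conditions on the entire past. Summing over the finitely many possible
  pasts turns it into a statement about the present alone.
\<close>

lemma prob_Suc:
  "\<P>(\<omega> in M. X (Suc t) \<omega> = y) = expectation (\<lambda>\<omega>. pmf (reshuffle_step N (X t \<omega>)) y)"
proof -
  define H where "H \<omega> = restrict (\<lambda>s. X s \<omega>) {..t}" for \<omega>
  define T where "T = {..t} \<rightarrow>\<^sub>E configurations N \<mu>"
  have T: "finite T"
    unfolding T_def by (intro finite_PiE finite_configurations) auto
  have H_T: "H \<omega> \<in> T" if "\<omega> \<in> space M" for \<omega>
    using X_in_configurations[OF that] by (auto simp: H_def T_def)
  have H_eq: "H \<omega> = h \<longleftrightarrow> (\<forall>s\<le>t. X s \<omega> = h s)" if "h \<in> T" for h \<omega>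
    using that by (auto simp: H_def T_def PiE_iff extensional_def fun_eq_iff)
  have ev_past: "{\<omega>\<in>space M. \<forall>s\<le>t. X s \<omega> = h s} \<in> events" for h
    using sets.sets_Collect_countable_Ball[of M "\<lambda>s \<omega>. X s \<omega> = h s" "{..t}",
      OF event_X[of "\<lambda>x. x = h _"]] unfolding Ball_def atMost_iff .
  have ev_H: "{\<omega>\<in>space M. H \<omega> = h} \<in> events" if "h \<in> T" for h
    unfolding H_eq[OF that] by (rule ev_past)
  have meas_H: "H \<in> measurable M (count_space T)"
    unfolding measurable_count_space_eq2[OF T]
  proof (intro conjI ballI)
    show "H \<in> space M \<rightarrow> T" using H_T by auto
    show "H -` {h} \<inter> space M \<in> events" if "h \<in> T" for h
      using ev_H[OF that] by (simp add: vimage_def Int_def conj_commute)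
  qed
  have step: "\<P>(\<omega> in M. X (Suc t) \<omega> = y \<and> H \<omega> = h) =
      pmf (reshuffle_step N (h t)) y * \<P>(\<omega> in M. H \<omega> = h)" if h: "h \<in> T" for h
  proof (cases "\<P>(\<omega> in M. H \<omega> = h) = 0")
    case True
    have "\<P>(\<omega> in M. X (Suc t) \<omega> = y \<and> H \<omega> = h) \<le> \<P>(\<omega> in M. H \<omega> = h)"
      by (rule finite_measure_mono[OF _ ev_H[OF h]]) blast
    then show ?thesis using True by (simp add: measure_le_0_iff)
  next
    case False
    then have pos: "\<P>(\<omega> in M. \<forall>s\<le>t. X s \<omega> = h s) > 0"
      by (simp add: H_eq[OF h] zero_less_measure_iff)
    then have "\<P>(\<omega> in M. X (Suc t) \<omega> = y \<bar> \<forall>s\<le>t. X s \<omega> = h s) =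
        pmf (reshuffle_step N (h t)) y"
      using chain by (simp add: binomial_reshuffling_def)
    then show ?thesis
      using pos by (simp add: cond_prob_def H_eq[OF h] field_simps)
  qed
  have "\<P>(\<omega> in M. X (Suc t) \<omega> = y) = (\<Sum>h\<in>T. \<P>(\<omega> in M. X (Suc t) \<omega> = y \<and> H \<omega> = h))"
  proof (rule prob_sum[OF T])
    show "{\<omega>\<in>space M. X (Suc t) \<omega> = y \<and> H \<omega> = h} \<in> events" if "h \<in> T" for h
      using ev_H[OF that] event_X[of "\<lambda>x. x = y" "Suc t"] by (rule sets.sets_Collect_conj)
  qed (use event_X[of "\<lambda>x. x = y" "Suc t"] H_T in auto)
  also have "\<dots> = (\<Sum>h\<in>T. pmf (reshuffle_step N (h t)) y * \<P>(\<omega> in M. H \<omega> = h))"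
    using step by simp
  also have "\<dots> = expectation (\<lambda>\<omega>. pmf (reshuffle_step N (H \<omega> t)) y)"
    by (rule expectation_finite_range[OF meas_H T, symmetric])
  finally show ?thesis by (simp add: H_def)
qed

lemma integrable_X: "integrable M (\<lambda>\<omega>. (g :: _ \<Rightarrow> real) (X t \<omega>))"
proof (rule integrable_const_bound)
  show "AE \<omega> in M. norm (g (X t \<omega>)) \<le> Max ((\<lambda>x. \<bar>g x\<bar>) ` configurations N \<mu>)"
    using X_in_configurations finite_configurations by (auto intro!: AE_I2 Max_ge)
  show "(\<lambda>\<omega>. g (X t \<omega>)) \<in> borel_measurable M"
    by (rule measurable_compose[OF measurable_X]) auto
qed

lemma expectation_Suc:
  fixes f :: "(nat \<Rightarrow> nat) \<Rightarrow> real"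
  shows "expectation (\<lambda>\<omega>. f (X (Suc t) \<omega>)) =
    expectation (\<lambda>\<omega>. measure_pmf.expectation (reshuffle_step N (X t \<omega>)) f)"
proof -
  let ?S = "configurations N \<mu>"
  have "expectation (\<lambda>\<omega>. f (X (Suc t) \<omega>)) =
      (\<Sum>y\<in>?S. f y * expectation (\<lambda>\<omega>. pmf (reshuffle_step N (X t \<omega>)) y))"
    by (simp add: expectation_finite_range[OF measurable_X finite_configurations] prob_Suc)
  also have "\<dots> = expectation (\<lambda>\<omega>. \<Sum>y\<in>?S. f y * pmf (reshuffle_step N (X t \<omega>)) y)"
    using integrable_X[of "\<lambda>x. pmf (reshuffle_step N x) _"]
    by (subst Bochner_Integration.integral_sum) auto
  also have "\<dots> = expectation (\<lambda>\<omega>. measure_pmf.expectation (reshuffle_step N (X t \<omega>)) f)"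
  proof (rule Bochner_Integration.integral_cong[OF refl])
    fix \<omega> assume "\<omega> \<in> space M"
    then show "(\<Sum>y\<in>?S. f y * pmf (reshuffle_step N (X t \<omega>)) y) =
        measure_pmf.expectation (reshuffle_step N (X t \<omega>)) f"
      by (intro integral_measure_pmf_real[symmetric] finite_configurations)
         (auto intro: reshuffle_step_configurations[OF two_agents X_in_configurations])
  qed
  finally show ?thesis .
qed

text \<open>
  The induction is over all weights at once: by duality, the expected monomial of \<open>u\<close> at time
  \<open>t + 1\<close> is the mean over the pairs of the expected monomials of the averaged weights at time \<open>t\<close>.
  The bound is linear in the spread, so that it survives this mean, and the contraction of the
  spread supplies the additional factor.
\<close>

lemma expectation_monomial_bound:
  assumes "\<And>k. 0 \<le> u k" "\<And>k. u k \<le> 1"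
  shows "\<bar>expectation (\<lambda>\<omega>. monomial N u (X t \<omega>)) - ((\<Sum>k=1..N. u k) / N) ^ m\<bar>
           \<le> m * contraction_rate N ^ t * spread N u"
  using assms
proof (induction t arbitrary: u)
  case 0
  let ?q = "((\<Sum>k=1..N. u k) / N) ^ m"
  have bound: "\<bar>monomial N u (X 0 \<omega>) - ?q\<bar> \<le> m * spread N u" if "\<omega> \<in> space M" for \<omega>
    using 0 two_agents sum_configuration[OF X_in_configurations[OF that]]
    by (intro monomial_diff_le_spread) auto
  have "\<bar>expectation (\<lambda>\<omega>. monomial N u (X 0 \<omega>)) - ?q\<bar> =
      \<bar>expectation (\<lambda>\<omega>. monomial N u (X 0 \<omega>) - ?q)\<bar>"
    by (subst Bochner_Integration.integral_diff) (auto simp: integrable_X prob_space)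
  also have "\<dots> \<le> expectation (\<lambda>\<omega>. \<bar>monomial N u (X 0 \<omega>) - ?q\<bar>)"
    by (rule integral_abs_bound)
  also have "\<dots> \<le> expectation (\<lambda>\<omega>. m * spread N u)"
    using bound integrable_X[of "\<lambda>x. \<bar>monomial N u x - ?q\<bar>" 0] by (intro integral_mono) auto
  finally show ?case by (simp add: prob_space)
next
  case (Suc t)
  let ?A = "agent_pairs N" and ?c = "real (card (agent_pairs N))"
  let ?q = "((\<Sum>k=1..N. u k) / N) ^ m"
  let ?E = "\<lambda>(i, j). expectation (\<lambda>\<omega>. monomial N (average_at i j u) (X t \<omega>))"
  let ?S = "\<lambda>(i, j). spread N (average_at i j u)"
  have c: "?c > 0"
    using agent_pairs_nonempty[OF two_agents] finite_agent_pairs[of N] by (simp add: card_gt_0_iff)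
  have IH: "\<bar>?E p - ?q\<bar> \<le> m * contraction_rate N ^ t * ?S p" if "p \<in> ?A" for p
  proof -
    obtain i j where p: "p = (i, j)" by fastforce
    have "0 \<le> average_at i j u k \<and> average_at i j u k \<le> 1" for k
    proof
      show "0 \<le> average_at i j u k" using Suc.prems(1) by (simp add: average_at_def)
      show "average_at i j u k \<le> 1"
        using Suc.prems(2)[of i] Suc.prems(2)[of j] Suc.prems(2)[of k] by (simp add: average_at_def)
    qed
    then show ?thesis
      using Suc.IH[of "average_at i j u"] sum_average_at[of i j N u] that by (simp add: p)
  qed
  have "expectation (\<lambda>\<omega>. monomial N u (X (Suc t) \<omega>)) = (\<Sum>p\<in>?A. ?E p) / ?c"
    by (simp add: expectation_Suc expectation_monomial_step[OF two_agents] case_prod_beta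
        Bochner_Integration.integral_sum integrable_X)
  then have "\<bar>expectation (\<lambda>\<omega>. monomial N u (X (Suc t) \<omega>)) - ?q\<bar> = \<bar>\<Sum>p\<in>?A. ?E p - ?q\<bar> / ?c"
  proof -
    have "(\<Sum>p\<in>?A. ?E p) / ?c - ?q = (\<Sum>p\<in>?A. ?E p - ?q) / ?c"
      using c by (simp add: sum_subtractf diff_divide_distrib)
    then show ?thesis
      using c \<open>expectation _ = _\<close> by (simp only: abs_divide abs_of_pos)
  qed
  also have "\<dots> \<le> (\<Sum>p\<in>?A. m * contraction_rate N ^ t * ?S p) / ?c"
    using IH by (intro divide_right_mono order_trans[OF sum_abs] sum_mono) auto
  also have "\<dots> = m * contraction_rate N ^ t * ((\<Sum>p\<in>?A. ?S p) / ?c)"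
    by (simp add: sum_distrib_left[symmetric])
  also have "\<dots> \<le> m * contraction_rate N ^ t * (contraction_rate N * spread N u)"
    using spread_average_contracts[OF two_agents] contraction_rate_bounds[OF two_agents]
    by (intro mult_left_mono) auto
  finally show ?case by (simp add: mult_ac)
qed

lemma X1_le: "\<omega> \<in> space M \<Longrightarrow> X t \<omega> 1 \<le> m"
  using sum_configuration[OF X_in_configurations, of \<omega> t] two_agents
    member_le_sum[of 1 "{1..N}" "X t \<omega>"] by auto

lemma expectation_power_tendsto:
  assumes s: "0 \<le> s" "s \<le> 1"
  shows "(\<lambda>t. expectation (\<lambda>\<omega>. s ^ X t \<omega> 1)) \<longlonglongrightarrow> (s / N + (1 - 1 / N)) ^ m"
proof -
  define u where "u = (\<lambda>k::nat. 1 :: real)(1 := s)"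
  have agents: "{1..N} = insert 1 {2..N}" using two_agents by auto
  have "monomial N u x = s ^ x 1" for x
    by (simp add: monomial_def agents u_def del: One_nat_def)
  moreover have "(\<Sum>k=1..N. u k) = s + (real N - 1)"
    using two_agents by (simp add: agents u_def of_nat_diff del: One_nat_def)
  moreover have "(s + (real N - 1)) / N = s / N + (1 - 1 / N)"
    using two_agents by (simp add: field_simps)
  ultimately have bound: "\<bar>expectation (\<lambda>\<omega>. s ^ X t \<omega> 1) - (s / N + (1 - 1 / N)) ^ m\<bar>
      \<le> m * contraction_rate N ^ t * spread N u" for t
    using expectation_monomial_bound[of u t] s by (simp add: u_def)
  have "(\<lambda>t. contraction_rate N ^ t) \<longlonglongrightarrow> 0"
    using contraction_rate_bounds[OF two_agents] by (intro LIMSEQ_power_zero) auto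
  then have lim: "(\<lambda>t. m * contraction_rate N ^ t * spread N u) \<longlonglongrightarrow> 0"
    by (intro tendsto_mult_left_zero tendsto_mult_right_zero)
  have "\<forall>\<^sub>F t in sequentially.
      norm (expectation (\<lambda>\<omega>. s ^ X t \<omega> 1) - (s / N + (1 - 1 / N)) ^ m)
        \<le> m * contraction_rate N ^ t * spread N u"
    unfolding real_norm_def by (intro always_eventually allI bound)
  then show ?thesis
    by (rule LIM_zero_cancel[OF Lim_null_comparison[OF _ lim]])
qed

end

section \<open>From generating functions to probabilities\<close>

text \<open>
  Dividing by \<open>X - c\<close> for a point \<open>c\<close> of convergence lowers the degree, and the quotient still
  converges to \<open>0\<close> at every other point.
\<close>

lemma coeff_tendsto_0:
  fixes p :: "'b \<Rightarrow> real poly"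
  assumes "infinite S" "\<And>t. degree (p t) \<le> d"
    and "\<And>s. s \<in> S \<Longrightarrow> ((\<lambda>t. poly (p t) s) \<longlongrightarrow> 0) F"
  shows "((\<lambda>t. coeff (p t) k) \<longlongrightarrow> 0) F"
  using assms
proof (induction d arbitrary: p S k)
  case 0
  obtain s where s: "s \<in> S" using "0.prems"(1) by (metis finite.emptyI ex_in_conv)
  have "coeff (p t) k = (if k = 0 then poly (p t) s else 0)" for t
  proof -
    obtain a where "p t = [:a:]" using "0.prems"(2)[of t] by (auto elim: degree_eq_zeroE)
    then show ?thesis by (simp add: coeff_pCons split: nat.split)
  qed
  then show ?case using "0.prems"(3)[OF s] by (cases "k = 0") simp_all
next
  case (Suc d)
  obtain c where c: "c \<in> S" using Suc.prems(1) by (metis finite.emptyI ex_in_conv)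
  define q where "q t = synthetic_div (p t) c" for t
  have p: "p t = [:- c, 1:] * q t + [:poly (p t) c:]" for t
    unfolding q_def by (rule synthetic_div_correct'[symmetric])
  have q0: "((\<lambda>t. coeff (q t) k) \<longlongrightarrow> 0) F" for k
  proof (rule Suc.IH)
    show "infinite (S - {c})" using Suc.prems(1) by simp
    show "degree (q t) \<le> d" for t
      using Suc.prems(2)[of t] by (simp add: q_def degree_synthetic_div)
    show "((\<lambda>t. poly (q t) s) \<longlongrightarrow> 0) F" if s: "s \<in> S - {c}" for s
    proof -
      have "poly (q t) s = (poly (p t) s - poly (p t) c) / (s - c)" for t
        using s by (subst p) (simp add: field_simps)
      moreover have "((\<lambda>t. (poly (p t) s - poly (p t) c) / (s - c)) \<longlongrightarrow> (0 - 0) / (s - c)) F"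
        using s c by (intro tendsto_intros Suc.prems(3)) auto
      ultimately show ?thesis by simp
    qed
  qed
  have "coeff (p t) k = - c * coeff (q t) k + (if k = 0 then 0 else coeff (q t) (k - 1))
      + (if k = 0 then poly (p t) c else 0)" for t
    by (subst p) (simp add: coeff_pCons split: nat.split)
  moreover have "((\<lambda>t. - c * coeff (q t) k) \<longlongrightarrow> 0) F"
    by (rule tendsto_mult_right_zero[OF q0])
  moreover have "((\<lambda>t. if k = 0 then 0 else coeff (q t) (k - 1)) \<longlongrightarrow> 0) F"
    using q0 by (cases "k = 0") simp_all
  moreover have "((\<lambda>t. if k = 0 then poly (p t) c else 0) \<longlongrightarrow> 0) F"
    using Suc.prems(3)[OF c] by (cases "k = 0") simp_all
  ultimately show ?case by (simp only: tendsto_add_zero)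
qed

lemma (in reshuffling_chain) prob_X1_tendsto:
  "(\<lambda>t. \<P>(\<omega> in M. X t \<omega> 1 = n))
     \<longlonglongrightarrow> real (m choose n) * (1 / real N) ^ n * (1 - 1 / real N) ^ (m - n)"
proof (cases "n \<le> m")
  case False
  then have empty: "{\<omega>\<in>space M. X t \<omega> 1 = n} = {}" for t
    using X1_le by fastforce
  show ?thesis using False by (simp only: empty) (simp add: binomial_eq_0 not_le)
next
  case True
  define b where "b k = real (m choose k) * (1 / real N) ^ k * (1 - 1 / real N) ^ (m - k)" for k
  \<comment> \<open>the generating function of \<open>X\<^sub>1(t)\<close> minus that of the binomial distribution\<close>
  define p where "p t = (\<Sum>k\<le>m. monom (\<P>(\<omega> in M. X t \<omega> 1 = k) - b k) k)" for t
  have meas: "(\<lambda>\<omega>. X t \<omega> 1) \<in> measurable M (count_space {..m})" for t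
  proof -
    have "(\<lambda>\<omega>. X t \<omega> 1) -` {a} \<inter> space M \<in> events" for a
      using event_X[of "\<lambda>x. x 1 = a" t] by (simp add: vimage_def Int_def conj_commute)
    then show ?thesis
      using X1_le by (auto simp: measurable_count_space_eq2)
  qed
  have poly_p: "poly (p t) s = expectation (\<lambda>\<omega>. s ^ X t \<omega> 1) - (s / N + (1 - 1 / N)) ^ m" for t s
  proof -
    have "(\<Sum>k\<le>m. b k * s ^ k) = (s / N + (1 - 1 / N)) ^ m"
      unfolding b_def by (subst binomial_ring) (simp add: power_divide mult_ac)
    moreover have "(\<Sum>k\<le>m. \<P>(\<omega> in M. X t \<omega> 1 = k) * s ^ k) = expectation (\<lambda>\<omega>. s ^ X t \<omega> 1)"
      unfolding expectation_finite_range[OF meas finite_atMost, of "\<lambda>k. s ^ k"]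
      by (intro sum.cong refl mult.commute)
    ultimately show ?thesis
      by (simp add: p_def poly_sum poly_monom left_diff_distrib sum_subtractf)
  qed
  have "(\<lambda>t. coeff (p t) n) \<longlonglongrightarrow> 0"
  proof (rule coeff_tendsto_0)
    show "infinite {0..1::real}" by (simp add: infinite_Icc)
    show "degree (p t) \<le> m" for t
      unfolding p_def by (intro degree_sum_le) (auto intro: order_trans[OF degree_monom_le])
    show "(\<lambda>t. poly (p t) s) \<longlonglongrightarrow> 0" if "s \<in> {0..1}" for s
      unfolding poly_p using that expectation_power_tendsto[of s] by (auto simp: LIM_zero_iff)
  qed
  moreover have "coeff (p t) n = \<P>(\<omega> in M. X t \<omega> 1 = n) - b n" for t
    using True by (simp add: p_def coeff_sum)
  ultimately show ?thesis
    by (simp add: LIM_zero_iff b_def)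
qed

section \<open>The Poisson limit\<close>

text \<open>
  For the admissible \<open>N\<close>, \<open>nat \<lfloor>N\<mu>\<rfloor>\<close> is the integer \<open>N\<mu>\<close>. The function \<open>g\<close> in the proof extends the
  binomial probability to all \<open>N\<close>, whether or not \<open>N\<mu>\<close> is an integer: the falling factorial and
  the power are replaced by expressions in the real number \<open>N\<mu>\<close>, and the limit along all of \<open>\<nat>\<close>
  is taken factor by factor.
\<close>

lemma binomial_tendsto_poisson:
  fixes \<mu> :: real
  assumes "\<mu> > 0"
  shows "((\<lambda>N. real (nat \<lfloor>real N * \<mu>\<rfloor> choose n) * (1 / real N) ^ n
              * (1 - 1 / real N) ^ (nat \<lfloor>real N * \<mu>\<rfloor> - n))
            \<longlongrightarrow> \<mu> ^ n * exp (- \<mu>) / fact n)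
          (sequentially \<sqinter> principal {N. 2 \<le> N \<and> real N * \<mu> \<in> \<nat>})"
proof -
  define g where "g N = (\<Prod>i<n. (real N * \<mu> - real i) / real N) / fact n
      * exp (real N * \<mu> * ln (1 - 1 / real N)) / (1 - 1 / real N) ^ n" for N
  \<comment> \<open>The binomial coefficient and \<open>(1 / N) ^ n\<close> combine to \<open>n\<close> factors with limit \<open>\<mu>\<close>.\<close>
  have factor: "(\<lambda>N. (real N * \<mu> - real i) / real N) \<longlonglongrightarrow> \<mu>" for i
    by real_asymp
  have expo: "(\<lambda>N. exp (real N * \<mu> * ln (1 - 1 / real N))) \<longlonglongrightarrow> exp (- \<mu>)"
    by real_asymp
  have base: "(\<lambda>N. 1 - 1 / real N) \<longlonglongrightarrow> 1"
    by real_asymp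
  have "g \<longlonglongrightarrow> (\<Prod>i<n. \<mu>) / fact n * exp (- \<mu>) / 1 ^ n"
    unfolding g_def by (intro tendsto_intros factor expo base) auto
  then have g: "g \<longlonglongrightarrow> \<mu> ^ n * exp (- \<mu>) / fact n"
    by simp
  have "filterlim (\<lambda>N. real N * \<mu>) at_top sequentially"
    using assms by real_asymp
  then have large: "\<forall>\<^sub>F N in sequentially. real n \<le> real N * \<mu>"
    by (simp add: filterlim_at_top)
  have eq: "g N = real (nat \<lfloor>real N * \<mu>\<rfloor> choose n) * (1 / real N) ^ n
              * (1 - 1 / real N) ^ (nat \<lfloor>real N * \<mu>\<rfloor> - n)"
    if N: "2 \<le> N" "real N * \<mu> \<in> \<nat>" and n: "real n \<le> real N * \<mu>" for N
  proof -
    obtain m where m: "real N * \<mu> = real m" using N(2) by (auto elim: Nats_cases)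
    have pos: "1 - 1 / real N > 0" using N(1) by simp
    have "n \<le> m" using n m by simp
    have "(\<Prod>i<n. (real m - real i) / real N) / fact n = real (m choose n) * (1 / real N) ^ n"
      by (simp add: binomial_gbinomial gbinomial_prod_rev prod_dividef power_divide
          atLeast0LessThan)
    moreover have "exp (real m * ln (1 - 1 / real N)) = (1 - 1 / real N) ^ m"
      using pos by (simp add: exp_of_nat_mult)
    moreover have "(1 - 1 / real N) ^ m / (1 - 1 / real N) ^ n = (1 - 1 / real N) ^ (m - n)"
      using pos \<open>n \<le> m\<close> by (intro power_diff[symmetric]) auto
    ultimately show ?thesis
      by (simp add: g_def m times_divide_eq_right[symmetric] del: times_divide_eq_right)
  qed
  show ?thesis
  proof (rule Lim_transform_eventually)
    show "(g \<longlongrightarrow> \<mu> ^ n * exp (- \<mu>) / fact n)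
        (sequentially \<sqinter> principal {N. 2 \<le> N \<and> real N * \<mu> \<in> \<nat>})"
      by (rule tendsto_mono[OF inf_le1 g])
    show "\<forall>\<^sub>F N in sequentially \<sqinter> principal {N. 2 \<le> N \<and> real N * \<mu> \<in> \<nat>}.
        g N = real (nat \<lfloor>real N * \<mu>\<rfloor> choose n) * (1 / real N) ^ n
              * (1 - 1 / real N) ^ (nat \<lfloor>real N * \<mu>\<rfloor> - n)"
      unfolding eventually_inf_principal using large by eventually_elim (auto intro: eq)
  qed
qed

theorem theorem2:
  fixes \<mu> :: real and n :: nat
  assumes "\<mu> > 0"
  shows "(\<forall>N m (M :: 'a measure) X.
            2 \<le> N \<and> real N * \<mu> = real m \<and> binomial_reshuffling M N \<mu> X \<longrightarrow>
            (\<lambda>t. \<P>(\<omega> in M. X t \<omega> 1 = n))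
              \<longlonglongrightarrow> real (m choose n) * (1 / real N) ^ n * (1 - 1 / real N) ^ (m - n)) \<and>
         (\<forall>(M :: nat \<Rightarrow> 'a measure) X.
            (\<forall>N. 2 \<le> N \<and> real N * \<mu> \<in> \<nat> \<longrightarrow> binomial_reshuffling (M N) N \<mu> (X N)) \<longrightarrow>
            ((\<lambda>N. lim (\<lambda>t. \<P>(\<omega> in M N. X N t \<omega> 1 = n)))
              \<longlongrightarrow> \<mu> ^ n * exp (- \<mu>) / fact n)
              (sequentially \<sqinter> principal {N. 2 \<le> N \<and> real N * \<mu> \<in> \<nat>}))"
proof -
  have limit: "(\<lambda>t. \<P>(\<omega> in M. X t \<omega> 1 = n))
      \<longlonglongrightarrow> real (m choose n) * (1 / real N) ^ n * (1 - 1 / real N) ^ (m - n)"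
    if "2 \<le> N" "real N * \<mu> = real m" "binomial_reshuffling M N \<mu> X"
    for N m and M :: "'a measure" and X
  proof -
    interpret prob_space M using that(3) by (simp add: binomial_reshuffling_def)
    interpret reshuffling_chain M N m \<mu> X by unfold_locales (use that in auto)
    show ?thesis by (rule prob_X1_tendsto)
  qed
  have poisson: "((\<lambda>N. lim (\<lambda>t. \<P>(\<omega> in M N. X N t \<omega> 1 = n)))
      \<longlongrightarrow> \<mu> ^ n * exp (- \<mu>) / fact n) (sequentially \<sqinter> principal {N. 2 \<le> N \<and> real N * \<mu> \<in> \<nat>})"
    if chains: "\<And>N. 2 \<le> N \<Longrightarrow> real N * \<mu> \<in> \<nat> \<Longrightarrow> binomial_reshuffling (M N) N \<mu> (X N)"
    for M :: "nat \<Rightarrow> 'a measure" and X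
  proof (rule Lim_transform_eventually[OF binomial_tendsto_poisson[OF assms]])
    have "real (nat \<lfloor>real N * \<mu>\<rfloor> choose n) * (1 / real N) ^ n
            * (1 - 1 / real N) ^ (nat \<lfloor>real N * \<mu>\<rfloor> - n) = lim (\<lambda>t. \<P>(\<omega> in M N. X N t \<omega> 1 = n))"
      if N: "2 \<le> N" "real N * \<mu> \<in> \<nat>" for N
    proof -
      have "real N * \<mu> = real (nat \<lfloor>real N * \<mu>\<rfloor>)" using N(2) by (auto elim!: Nats_cases)
      from limI[OF limit[OF N(1) this chains[OF N]]] show ?thesis by simp
    qed
    then show "\<forall>\<^sub>F N in sequentially \<sqinter> principal {N. 2 \<le> N \<and> real N * \<mu> \<in> \<nat>}.
        real (nat \<lfloor>real N * \<mu>\<rfloor> choose n) * (1 / real N) ^ n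
          * (1 - 1 / real N) ^ (nat \<lfloor>real N * \<mu>\<rfloor> - n) = lim (\<lambda>t. \<P>(\<omega> in M N. X N t \<omega> 1 = n))"
      by (simp add: eventually_inf_principal)
  qed
  show ?thesis using limit poisson by blast
qed

end
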